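(* There exists a subshift that is period stable, has no periodic points, and is not language stable.
   Context: A subshift $X\subseteq\mathcal{A}^{\mathbb{Z}}$ ($\mathcal{A}$ a finite alphabet) is a nonempty, closed set invariant under the left shift $\sigma$. Let $\mathcal{L}_n(X)$ be the set of words of length $n$ that occur in some element of $X$. The SFT cover of $X$ is the sequence $\{X_n\}_{n\geq 1}$, where $X_n$ is the set of all $x\in\mathcal{A}^{\mathbb{Z}}$ in which no word of $\bigcup_{k=1}^n(\mathcal{A}^k\setminus\mathcal{L}_k(X))$ occurs. For a subshift $W$ and $p\in\mathbb{N}=\{1,2,\dots\}$, $\mathcal{P}_p(W)$ denotes the set of points of $W$ that are periodic under $\sigma$ with minimal period exactly $p$. The subshift $X$ is period stable if for every $m\in\mathbb{N}$ there exist $n,p\in\mathbb{N}$ such that $\mathcal{P}_p(X_n)=\mathcal{P}_p(X_{n+m})\neq\emptyset$. The subshift $X$ is language stable if for every $j\in\mathbb{N}$ there exists $m\in\mathbb{N}$ such that $X_m=X_{m+j}$. *)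

theory Defs
  imports "HOL-Analysis.Function_Topology"
begin

definition shift :: "(int \<Rightarrow> 'a) \<Rightarrow> int \<Rightarrow> 'a"
  where "shift x = (\<lambda>i. x (i + 1))"

text \<open>The alphabet is a set \<open>A\<close> rather than a type, so that one can quantify over it.
  Since \<open>product_topology\<close> has topological space \<open>UNIV \<rightarrow> A\<close> here, \<open>closedin\<close>
  includes that all points of \<open>X\<close> take values in \<open>A\<close>.\<close>

definition subshift :: "'a set \<Rightarrow> (int \<Rightarrow> 'a) set \<Rightarrow> bool"
  where "subshift A X \<longleftrightarrow>
    finite A \<and> X \<noteq> {} \<and>
    closedin (product_topology (\<lambda>_. discrete_topology A) (UNIV :: int set)) X \<and>
    shift ` X = X"

definition occurs_in :: "'a list \<Rightarrow> (int \<Rightarrow> 'a) \<Rightarrow> bool"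
  where "occurs_in w x \<longleftrightarrow> (\<exists>i. \<forall>j<length w. x (i + int j) = w ! j)"

definition words :: "'a set \<Rightarrow> nat \<Rightarrow> 'a list set"
  where "words A n = {w. set w \<subseteq> A \<and> length w = n}"

definition language :: "nat \<Rightarrow> (int \<Rightarrow> 'a) set \<Rightarrow> 'a list set"
  where "language n X = {w. length w = n \<and> (\<exists>x\<in>X. occurs_in w x)}"

definition sft_cover :: "'a set \<Rightarrow> (int \<Rightarrow> 'a) set \<Rightarrow> nat \<Rightarrow> (int \<Rightarrow> 'a) set"
  where "sft_cover A X n =
    {x. range x \<subseteq> A \<and> (\<forall>w \<in> (\<Union>k\<in>{1..n}. words A k - language k X). \<not> occurs_in w x)}"

definition periodic_point :: "(int \<Rightarrow> 'a) \<Rightarrow> bool"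
  where "periodic_point x \<longleftrightarrow> (\<exists>p\<ge>1. (shift ^^ p) x = x)"

definition points_of_period :: "nat \<Rightarrow> (int \<Rightarrow> 'a) set \<Rightarrow> (int \<Rightarrow> 'a) set"
  where "points_of_period p W =
    {x \<in> W. p \<ge> 1 \<and> (shift ^^ p) x = x \<and> (\<forall>q. 1 \<le> q \<and> q < p \<longrightarrow> (shift ^^ q) x \<noteq> x)}"

definition period_stable :: "'a set \<Rightarrow> (int \<Rightarrow> 'a) set \<Rightarrow> bool"
  where "period_stable A X \<longleftrightarrow>
    (\<forall>m\<ge>1. \<exists>n\<ge>1. \<exists>p\<ge>1.
       points_of_period p (sft_cover A X n) = points_of_period p (sft_cover A X (n + m)) \<and>
       points_of_period p (sft_cover A X n) \<noteq> {})"

definition language_stable :: "'a set \<Rightarrow> (int \<Rightarrow> 'a) set \<Rightarrow> bool"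
  where "language_stable A X \<longleftrightarrow>
    (\<forall>j\<ge>1. \<exists>m\<ge>1. sft_cover A X m = sft_cover A X (m + j))"

end

theory Submission
  imports Defs
begin

text \<open>
  The example marks at most one position of a point of an aperiodic Toeplitz-type subshift.

  \<^item> Aperiodicity comes from the Toeplitz part. For a chain \<open>N 0 dvd N 1 dvd \<dots>\<close> let
  \<open>toeplitz i\<close> be the parity of the largest \<open>k\<close> with \<open>N k dvd i\<close>. If \<open>p\<close> has largest such index
  \<open>k\<close>, then translation by \<open>p\<close> moves every point of index \<open>k + 1\<close> to a point of index \<open>k\<close>, hence
  changes the symbol, and points of index \<open>k + 1\<close> occur in every long window
  (\<open>marked_toeplitz_aperiodic\<close>).

  \<^item> Language instability comes from the mark. Two marks at distance \<open>m\<close> are forbidden, but this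
  is visible only in words of length greater than \<open>m\<close>, so each cover is strictly smaller than
  the previous one (\<open>marked_toeplitz_cover_strict\<close>).

  \<^item> Period stability comes from the growth of \<open>N\<close>. On \<open>{0<..<N (k + 1)}\<close> the Toeplitz
  sequence agrees with a sequence of period \<open>N k\<close>, so the covers of order up to
  \<open>N (k + 1) - N k\<close> contain a point of some fixed period \<open>p \<le> N k\<close>. There are at most
  \<open>card A ^ p\<close> points of period \<open>p\<close>, and the sets of those lying in successive covers decrease.
  Once \<open>N (k + 1)\<close> is so large that the range of orders exceeds \<open>card A ^ p + 1\<close> blocks of
  length \<open>m\<close>, the set has to stay constant along one block (\<open>stable_period_window\<close>).
\<close>

section \<open>Shift covers and their periodic points\<close>

lemma shift_funpow: "(shift ^^ n) x = (\<lambda>i. x (i + int n))"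
  by (induction n) (auto simp: shift_def algebra_simps)

lemma shift_periodic_multiple:
  assumes "(shift ^^ p) x = x"
  shows "x (i + int k * int p) = x i"
proof (induction k)
  case (Suc k)
  have "x (i + int (Suc k) * int p) = (shift ^^ p) x (i + int k * int p)"
    by (simp add: shift_funpow algebra_simps)
  then show ?case using Suc assms by simp
qed simp

lemma shift_periodic_mod:
  assumes "(shift ^^ p) x = x"
  shows "x (i mod int p) = x i"
proof (cases "0 \<le> i div int p")
  case True
  then show ?thesis
    using shift_periodic_multiple[OF assms, of "i mod int p" "nat (i div int p)"]
    by (simp add: mult.commute)
next
  case False
  then have "i mod int p = i + int (nat (- (i div int p))) * int p"
    by (simp add: minus_mult_div_eq_mod[symmetric] mult.commute)
  then show ?thesis
    using shift_periodic_multiple[OF assms, of i "nat (- (i div int p))"] by simp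
qed

lemma sft_cover_antimono: "n \<le> n' \<Longrightarrow> sft_cover A X n' \<subseteq> sft_cover A X n"
  unfolding sft_cover_def by fastforce

lemma points_of_period_mono: "W \<subseteq> W' \<Longrightarrow> points_of_period p W \<subseteq> points_of_period p W'"
  unfolding points_of_period_def by auto

lemma sft_coverI:
  assumes "range x \<subseteq> A"
    and "\<And>i. \<exists>x'\<in>X. \<exists>i'. \<forall>j<n. x (i + int j) = x' (i' + int j)"
  shows "x \<in> sft_cover A X n"
proof -
  have "w \<in> language k X" if k: "k \<le> n" "w \<in> words A k" "occurs_in w x" for k w
  proof -
    obtain i where i: "\<forall>j<length w. x (i + int j) = w ! j"
      using k(3) unfolding occurs_in_def by blast
    obtain x' i' where x': "x' \<in> X" "\<forall>j<n. x (i + int j) = x' (i' + int j)"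
      using assms(2) by blast
    have len: "length w = k" using k(2) by (simp add: words_def)
    have "occurs_in w x'"
      unfolding occurs_in_def using i x'(2) k(1) len by (intro exI[of _ i']) auto
    then show ?thesis using x'(1) len unfolding language_def by blast
  qed
  then show ?thesis using assms(1) by (auto simp: sft_cover_def)
qed

lemma points_of_period_finite_card:
  assumes "finite A"
  shows "finite (points_of_period p (sft_cover A X n))"
    and "card (points_of_period p (sft_cover A X n)) \<le> card A ^ p"
proof -
  let ?F = "points_of_period p (sft_cover A X n)"
  let ?f = "\<lambda>x. map (\<lambda>i. x (int i)) [0..<p]"
  let ?W = "{w. set w \<subseteq> A \<and> length w = p}"
  have W: "finite ?W" "card ?W = card A ^ p"
    using assms by (auto simp: finite_lists_length_eq card_lists_length_eq)
  have sub: "?f ` ?F \<subseteq> ?W"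
    unfolding points_of_period_def sft_cover_def by (auto simp: image_subset_iff)
  have inj: "inj_on ?f ?F"
  proof (rule inj_onI)
    fix x x' assume x: "x \<in> ?F" and x': "x' \<in> ?F" and eq: "?f x = ?f x'"
    then have p: "(shift ^^ p) x = x" "(shift ^^ p) x' = x'" "p \<ge> 1"
      by (auto simp: points_of_period_def)
    show "x = x'"
    proof
      fix i
      have "nat (i mod int p) < p" using p(3) by (simp add: nat_less_iff)
      then have "x (i mod int p) = x' (i mod int p)"
        using arg_cong[OF eq, of "\<lambda>w. w ! nat (i mod int p)"] p(3) by simp
      then show "x i = x' i" using shift_periodic_mod p by metis
    qed
  qed
  show "finite ?F" using finite_imageD[OF finite_subset[OF sub W(1)] inj] .
  show "card ?F \<le> card A ^ p" using card_inj_on_le[OF inj sub W(1)] W(2) by simp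
qed

text \<open>A pigeonhole argument: along the orders \<open>1, 1 + m, 1 + 2 * m, \<dots>\<close> the sets of points of
  period \<open>p\<close> decrease, and a finite set can strictly decrease only as often as its
  cardinality permits.\<close>

lemma stable_period_window:
  assumes "finite A"
    and u: "u \<in> points_of_period p (sft_cover A X (1 + (card A ^ p + 1) * m))"
  shows "\<exists>n\<ge>1. points_of_period p (sft_cover A X n) = points_of_period p (sft_cover A X (n + m))
           \<and> points_of_period p (sft_cover A X n) \<noteq> {}"
proof -
  define F where "F j = points_of_period p (sft_cover A X (1 + j * m))" for j
  have anti: "F j' \<subseteq> F j" if "j \<le> j'" for j j'
    unfolding F_def using that by (intro points_of_period_mono sft_cover_antimono) simp
  have "\<exists>j\<le>card A ^ p. F j = F (Suc j)"
  proof (rule ccontr)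
    assume neq: "\<not> (\<exists>j\<le>card A ^ p. F j = F (Suc j))"
    have "card (F j) + j \<le> card A ^ p" if "j \<le> card A ^ p + 1" for j
      using that
    proof (induction j)
      case 0
      then show ?case using points_of_period_finite_card(2)[OF assms(1)] by (simp add: F_def)
    next
      case (Suc j)
      have "j \<le> card A ^ p" using Suc.prems by simp
      then have "F j \<noteq> F (Suc j)" using neq by simp
      moreover have "F (Suc j) \<subseteq> F j" by (rule anti) simp
      ultimately have "F (Suc j) \<subset> F j" by (simp add: psubset_eq)
      then have "card (F (Suc j)) < card (F j)"
        using points_of_period_finite_card(1)[OF assms(1)] unfolding F_def
        by (intro psubset_card_mono)
      then show ?case using Suc by simp
    qed
    from this[of "card A ^ p + 1"] show False by simp
  qed
  then obtain j where j: "j \<le> card A ^ p" "F j = F (Suc j)" by blast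
  have "u \<in> F j" using u anti[of j "card A ^ p + 1"] j(1) unfolding F_def by fastforce
  then show ?thesis
    using j(2) by (intro exI[of _ "1 + j * m"]) (auto simp: F_def algebra_simps)
qed

section \<open>A Toeplitz sequence with fast growing periods\<close>

text \<open>The factor is chosen such that \<open>N (Suc k) - N k\<close> exceeds the order that
  \<open>stable_period_window\<close> requires for \<open>m = k\<close>, for an alphabet with four symbols and a period
  of at most \<open>N k\<close>.\<close>

fun N :: "nat \<Rightarrow> nat" where
  "N 0 = 1"
| "N (Suc k) = N k * (2 + (4 ^ N k + 1) * k)"

text \<open>This is the largest \<open>k\<close> with \<open>N k dvd i\<close> if \<open>i \<noteq> 0\<close>. No such \<open>k\<close> exists for \<open>i = 0\<close>; there
  an arbitrary value fills the one hole of the Toeplitz sequence.\<close>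

definition depth :: "int \<Rightarrow> nat"
  where "depth i = (LEAST k. \<not> int (N (Suc k)) dvd i)"

definition toeplitz :: "int \<Rightarrow> nat"
  where "toeplitz i = depth i mod 2"

lemma N_pos: "N k \<ge> 1"
  by (induction k) auto

lemma N_less_Suc: "N k < N (Suc k)"
  using N_pos[of k] by simp

lemma N_growth: "1 + (4 ^ N k + 1) * k + N k \<le> N (Suc k)"
proof -
  have "1 * (1 + (4 ^ N k + 1) * k) \<le> N k * (1 + (4 ^ N k + 1) * k)"
    using N_pos by (intro mult_right_mono) auto
  then show ?thesis by (simp add: algebra_simps)
qed

lemma N_dvd: "k \<le> l \<Longrightarrow> int (N k) dvd int (N l)"
  by (induction l rule: dec_induct) (simp_all add: dvd_mult2)

lemma N_gt: "k < N k"
proof (induction k)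
  case (Suc k)
  then show ?case using N_less_Suc[of k] by linarith
qed simp

lemma depth_eqI:
  assumes "int (N k) dvd i" "\<not> int (N (Suc k)) dvd i"
  shows "depth i = k"
  unfolding depth_def
proof (rule Least_equality)
  fix j assume "\<not> int (N (Suc j)) dvd i"
  then show "k \<le> j" using assms(1) N_dvd[of "Suc j" k] by (meson dvd_trans not_less_eq_eq)
qed (use assms in simp)

lemma depth_dvd:
  assumes "i \<noteq> 0"
  shows "int (N (depth i)) dvd i" "\<not> int (N (Suc (depth i))) dvd i"
proof -
  have "\<exists>k. \<not> int (N (Suc k)) dvd i"
  proof (rule ccontr)
    assume "\<not> ?thesis"
    then have "int (N (Suc (nat \<bar>i\<bar>))) \<le> \<bar>i\<bar>" using assms dvd_imp_le_int[of i "int (N (Suc (nat \<bar>i\<bar>)))"] by (simp del: N.simps)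
    then show False using N_gt[of "Suc (nat \<bar>i\<bar>)"] by linarith
  qed
  then show n: "\<not> int (N (Suc (depth i))) dvd i" unfolding depth_def by (rule LeastI_ex)
  show "int (N (depth i)) dvd i"
  proof (cases "depth i")
    case (Suc l)
    then show ?thesis using not_less_Least[of l "\<lambda>k. \<not> int (N (Suc k)) dvd i"]
      by (auto simp: depth_def simp del: N.simps)
  qed simp
qed

text \<open>The periodic sequence that approximates \<open>toeplitz\<close>: all multiples of \<open>N k\<close> are treated as
  if their depth were exactly \<open>k\<close>.\<close>

definition toeplitz_approx :: "nat \<Rightarrow> int \<Rightarrow> nat"
  where "toeplitz_approx k i = (if int (N k) dvd i then k else depth i) mod 2"

lemma toeplitz_approx_periodic: "toeplitz_approx k (i + int (N k)) = toeplitz_approx k i"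
proof (cases "int (N k) dvd i")
  case False
  then have "i \<noteq> 0" by auto
  note d = depth_dvd[OF this]
  \<comment> \<open>A non-multiple of \<open>N k\<close> has depth below \<open>k\<close>, which only depends on its residue.\<close>
  have "depth i < k" using False d(1) N_dvd[of k "depth i"] by (meson dvd_trans not_le)
  then have "int (N (depth i)) dvd int (N k)" "int (N (Suc (depth i))) dvd int (N k)"
    using N_dvd by (simp_all del: N.simps)
  then have "depth (i + int (N k)) = depth i"
    using d by (intro depth_eqI) (simp_all del: N.simps add: dvd_add_left_iff)
  then show ?thesis using False by (simp add: toeplitz_approx_def)
qed (simp add: toeplitz_approx_def)

lemma toeplitz_approx_eq:
  assumes "0 < i" "i < int (N (Suc k))"
  shows "toeplitz_approx k i = toeplitz i"
proof (cases "int (N k) dvd i")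
  case True
  have "depth i = k" using True assms zdvd_not_zless by (intro depth_eqI) blast+
  with True show ?thesis by (simp add: toeplitz_approx_def toeplitz_def)
qed (simp add: toeplitz_approx_def toeplitz_def)

section \<open>The orbit closure with at most one marked position\<close>

text \<open>The symbol \<open>a + 2 * b\<close> encodes the Toeplitz symbol \<open>a\<close> and the mark \<open>b\<close>. The second
  condition expresses that the Toeplitz part lies in the orbit closure of \<open>toeplitz\<close>.\<close>

definition marked_toeplitz :: "(int \<Rightarrow> nat) set"
  where "marked_toeplitz = {x. range x \<subseteq> {..<4} \<and>
    (\<forall>n::nat. \<exists>t. \<forall>i. \<bar>i\<bar> \<le> int n \<longrightarrow> x i mod 2 = toeplitz (t + i)) \<and>
    (\<forall>i j. x i \<ge> 2 \<and> x j \<ge> 2 \<longrightarrow> i = j)}"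

lemma toeplitz_less: "toeplitz i < 2"
  by (simp add: toeplitz_def)

lemma marked_toeplitzI:
  assumes "\<And>i. x i < 4" "\<And>i. x i mod 2 = toeplitz i"
    and "\<And>i j. x i \<ge> 2 \<Longrightarrow> x j \<ge> 2 \<Longrightarrow> i = j"
  shows "x \<in> marked_toeplitz"
proof -
  have "\<exists>t. \<forall>i. \<bar>i\<bar> \<le> int n \<longrightarrow> x i mod 2 = toeplitz (t + i)" for n
    by (rule exI[of _ 0]) (simp add: assms(2))
  moreover have "range x \<subseteq> {..<4}" using assms(1) by auto
  ultimately show ?thesis using assms(3) unfolding marked_toeplitz_def by blast
qed

lemma toeplitz_mem: "toeplitz \<in> marked_toeplitz"
proof (rule marked_toeplitzI)
  show "toeplitz i < 4" "toeplitz i mod 2 = toeplitz i" for i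
    using toeplitz_less[of i] by simp_all
  show "i = j" if "toeplitz i \<ge> 2" for i j
    using toeplitz_less[of i] that by simp
qed

lemma toeplitz_mark_mem: "(\<lambda>i. toeplitz i + (if i = a then 2 else 0)) \<in> marked_toeplitz"
proof (rule marked_toeplitzI)
  show "toeplitz i + (if i = a then 2 else 0) < 4"
       "(toeplitz i + (if i = a then 2 else 0)) mod 2 = toeplitz i" for i
    using toeplitz_less[of i] by auto
  show "i = j" if "toeplitz i + (if i = a then 2 else 0) \<ge> 2"
                  "toeplitz j + (if j = a then 2 else 0) \<ge> 2" for i j
    using toeplitz_less[of i] toeplitz_less[of j] that by (auto split: if_splits)
qed

lemma marked_toeplitz_translate:
  assumes "x \<in> marked_toeplitz"
  shows "(\<lambda>i. x (i + c)) \<in> marked_toeplitz"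
proof -
  have "\<exists>t. \<forall>i. \<bar>i\<bar> \<le> int n \<longrightarrow> x (i + c) mod 2 = toeplitz (t + i)" for n
  proof -
    obtain t where t: "\<And>i. \<bar>i\<bar> \<le> int (n + nat \<bar>c\<bar>) \<Longrightarrow> x i mod 2 = toeplitz (t + i)"
      using assms unfolding marked_toeplitz_def by blast
    show ?thesis
      by (rule exI[of _ "t + c"]) (auto simp: t algebra_simps)
  qed
  moreover have "i = j" if "x (i + c) \<ge> 2" "x (j + c) \<ge> 2" for i j
    using assms that unfolding marked_toeplitz_def by fastforce
  moreover have "range (\<lambda>i. x (i + c)) \<subseteq> {..<4}"
    using assms unfolding marked_toeplitz_def by blast
  ultimately show ?thesis unfolding marked_toeplitz_def by blast
qed

lemma marked_toeplitz_limit: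
  assumes "range x \<subseteq> {..<4}"
    and approx: "\<And>n::nat. \<exists>x'\<in>marked_toeplitz. \<forall>i. \<bar>i\<bar> \<le> int n \<longrightarrow> x' i = x i"
  shows "x \<in> marked_toeplitz"
proof -
  have "\<exists>t. \<forall>i. \<bar>i\<bar> \<le> int n \<longrightarrow> x i mod 2 = toeplitz (t + i)" for n
  proof -
    obtain x' where x': "x' \<in> marked_toeplitz" "\<And>i. \<bar>i\<bar> \<le> int n \<Longrightarrow> x' i = x i"
      using approx[of n] by blast
    obtain t where "\<And>i. \<bar>i\<bar> \<le> int n \<Longrightarrow> x' i mod 2 = toeplitz (t + i)"
      using x'(1) unfolding marked_toeplitz_def by blast
    with x'(2) show ?thesis by (intro exI[of _ t]) simp
  qed
  moreover have "i = j" if "x i \<ge> 2" "x j \<ge> 2" for i j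
  proof -
    obtain x' where x': "x' \<in> marked_toeplitz" "\<And>l. \<bar>l\<bar> \<le> int (nat \<bar>i\<bar> + nat \<bar>j\<bar>) \<Longrightarrow> x' l = x l"
      using approx[of "nat \<bar>i\<bar> + nat \<bar>j\<bar>"] by blast
    have "x' i \<ge> 2" "x' j \<ge> 2" using that x'(2)[of i] x'(2)[of j] by simp_all
    then show ?thesis using x'(1) unfolding marked_toeplitz_def by blast
  qed
  ultimately show ?thesis using assms(1) unfolding marked_toeplitz_def by blast
qed

lemma marked_toeplitz_subshift: "subshift {..<4} marked_toeplitz"
proof -
  let ?T = "product_topology (\<lambda>_. discrete_topology {..<4::nat}) (UNIV :: int set)"
  have top: "topspace ?T = {x. range x \<subseteq> {..<4}}"
    by (auto simp: PiE_UNIV_domain)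
  have "openin ?T (topspace ?T - marked_toeplitz)"
  proof (subst openin_subopen, intro ballI)
    fix x assume x: "x \<in> topspace ?T - marked_toeplitz"
    then obtain n :: nat where n: "\<not> (\<exists>x'\<in>marked_toeplitz. \<forall>i. \<bar>i\<bar> \<le> int n \<longrightarrow> x' i = x i)"
      using marked_toeplitz_limit top by blast
    have x4: "x i < 4" for i using x top by blast
    define C where "C = Pi\<^sub>E (UNIV :: int set) (\<lambda>i. if \<bar>i\<bar> \<le> int n then {x i} else {..<4})"
    have "finite {i. \<bar>i\<bar> \<le> int n}"
      by (rule finite_subset[of _ "{- int n..int n}"]) auto
    then have fin: "finite {i. (if \<bar>i\<bar> \<le> int n then {x i} else {..<4}) \<noteq> {..<4}}"
      by (rule rev_finite_subset) auto
    have "openin ?T C"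
      unfolding C_def
    proof (rule product_topology_basis)
      show "openin (discrete_topology {..<4}) (if \<bar>i\<bar> \<le> int n then {x i} else {..<4})" for i
        using x4[of i] by simp
    qed (use fin in simp)
    moreover have "x \<in> C" using x4 by (auto simp: C_def)
    moreover have "C \<subseteq> topspace ?T - marked_toeplitz"
    proof
      fix x' assume x': "x' \<in> C"
      then have "x' i \<in> (if \<bar>i\<bar> \<le> int n then {x i} else {..<4})" for i
        unfolding C_def by (rule PiE_mem) simp
      note x'' = this
      have "x' i < 4" for i using x''[of i] x4[of i] by (cases "\<bar>i\<bar> \<le> int n") auto
      then have "range x' \<subseteq> {..<4}" by blast
      moreover have "x' i = x i" if "\<bar>i\<bar> \<le> int n" for i using x''[of i] that by simp
      ultimately show "x' \<in> topspace ?T - marked_toeplitz" using n top by blast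
    qed
    ultimately show "\<exists>C. openin ?T C \<and> x \<in> C \<and> C \<subseteq> topspace ?T - marked_toeplitz" by blast
  qed
  then have "closedin ?T marked_toeplitz"
    unfolding closedin_def using top by (simp add: marked_toeplitz_def subset_iff)
  moreover have "shift ` marked_toeplitz = marked_toeplitz"
  proof
    show "shift ` marked_toeplitz \<subseteq> marked_toeplitz"
      using marked_toeplitz_translate[of _ 1] by (auto simp only: shift_def)
    show "marked_toeplitz \<subseteq> shift ` marked_toeplitz"
    proof
      fix x assume "x \<in> marked_toeplitz"
      then show "x \<in> shift ` marked_toeplitz"
        by (intro image_eqI[OF _ marked_toeplitz_translate[of x "-1"]]) (simp_all add: shift_def)
    qed
  qed
  moreover have "marked_toeplitz \<noteq> {}" using toeplitz_mem by blast
  ultimately show ?thesis by (simp add: subshift_def)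
qed

text \<open>A period \<open>p\<close> of depth \<open>k\<close> would identify a position of depth \<open>k + 1\<close> with one of depth \<open>k\<close>,
  although the two depths have different parities.\<close>

lemma marked_toeplitz_aperiodic:
  assumes x: "x \<in> marked_toeplitz"
  shows "\<not> periodic_point x"
proof
  assume "periodic_point x"
  then obtain p where p: "p \<ge> 1" "(shift ^^ p) x = x" by (auto simp: periodic_point_def)
  define k where "k = depth (int p)"
  have k: "int (N k) dvd int p" "\<not> int (N (Suc k)) dvd int p"
    using depth_dvd[of "int p"] p(1) by (simp_all add: k_def del: N.simps)
  let ?M = "N (Suc (Suc k))"
  obtain t where t: "\<And>i. \<bar>i\<bar> \<le> int (?M + p) \<Longrightarrow> x i mod 2 = toeplitz (t + i)"
    using x unfolding marked_toeplitz_def by blast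
  \<comment> \<open>The residue \<open>N (k + 1)\<close> modulo \<open>N (k + 2)\<close> guarantees depth exactly \<open>k + 1\<close>.\<close>
  define i where "i = (int (N (Suc k)) - t) mod int ?M"
  have M: "int ?M > 0" using N_pos[of "Suc (Suc k)"] by linarith
  have i: "0 \<le> i" "i < int ?M" using M by (simp_all add: i_def del: N.simps)
  have "(t + i) mod int ?M = int (N (Suc k)) mod int ?M"
    by (simp add: i_def mod_simps del: N.simps)
  also have "\<dots> = int (N (Suc k))" using N_less_Suc[of "Suc k"] by (simp del: N.simps)
  finally have ti: "(t + i) mod int ?M = int (N (Suc k))" .
  have d1: "int (N (Suc k)) dvd t + i"
    using ti N_dvd[of "Suc k" "Suc (Suc k)"] by (metis dvd_mod_iff dvd_refl le_SucI le_refl)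
  have d2: "\<not> int ?M dvd t + i"
    using ti N_pos[of "Suc k"] by (simp add: dvd_eq_mod_eq_0 del: N.simps)
  have "depth (t + i) = Suc k" using d1 d2 by (rule depth_eqI)
  moreover have "depth (t + i + int p) = k"
  proof (rule depth_eqI)
    show "int (N k) dvd t + i + int p"
      using d1 k(1) N_dvd[of k "Suc k"] by (meson dvd_add dvd_trans le_SucI le_refl)
    show "\<not> int (N (Suc k)) dvd t + i + int p"
      using d1 k(2) by (simp add: dvd_add_right_iff del: N.simps)
  qed
  moreover have "x i mod 2 = toeplitz (t + i)" using i by (intro t) simp
  moreover have "x (i + int p) mod 2 = toeplitz (t + (i + int p))" using i by (intro t) simp
  moreover have "x (i + int p) = x i" using shift_periodic_multiple[OF p(2), of i 1] by simp
  ultimately have "Suc k mod 2 = k mod 2" by (simp add: toeplitz_def add.assoc)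
  then show False by presburger
qed

text \<open>Two marks at distance \<open>m\<close> separate the covers of order \<open>m\<close> and \<open>m + 1\<close>: a window of
  length \<open>m\<close> sees at most one of them.\<close>

lemma marked_toeplitz_cover_strict:
  assumes "m \<ge> 1"
  shows "sft_cover {..<4} marked_toeplitz m \<noteq> sft_cover {..<4} marked_toeplitz (m + 1)"
proof -
  define x where "x i = toeplitz i + (if i = 0 \<or> i = int m then 2 else 0)" for i
  have ran: "range x \<subseteq> {..<4}"
  proof
    fix a assume "a \<in> range x"
    then obtain i where "a = x i" by blast
    then show "a \<in> {..<4}" using toeplitz_less[of i] by (simp add: x_def)
  qed
  have "x \<in> sft_cover {..<4} marked_toeplitz m"
  proof (rule sft_coverI[OF ran])
    fix i
    show "\<exists>x'\<in>marked_toeplitz. \<exists>i'. \<forall>j<m. x (i + int j) = x' (i' + int j)"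
      by (rule bexI[OF _ toeplitz_mark_mem[of "if i \<le> 0 then 0 else int m"]], rule exI[of _ i])
        (auto simp: x_def)
  qed
  moreover have "x \<notin> sft_cover {..<4} marked_toeplitz (m + 1)"
  proof
    let ?w = "map (\<lambda>j. x (int j)) [0..<Suc m]"
    assume "x \<in> sft_cover {..<4} marked_toeplitz (m + 1)"
    moreover have "occurs_in ?w x"
      unfolding occurs_in_def by (rule exI[of _ 0]) (simp del: upt_Suc)
    moreover have "?w \<in> words {..<4} (Suc m)" using ran by (auto simp: words_def)
    ultimately have "?w \<in> language (Suc m) marked_toeplitz"
      unfolding sft_cover_def by fastforce
    then obtain x' i where x': "x' \<in> marked_toeplitz"
        "\<And>j. j < Suc m \<Longrightarrow> x' (i + int j) = x (int j)"
      by (auto simp: language_def occurs_in_def simp del: upt_Suc)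
    have "x' (i + int 0) \<ge> 2" "x' (i + int m) \<ge> 2"
      by (subst x'(2); simp add: x_def)+
    then have "i + int 0 = i + int m" using x'(1) unfolding marked_toeplitz_def by blast
    then show False using assms by simp
  qed
  ultimately show ?thesis by blast
qed

lemma toeplitz_approx_in_cover:
  assumes "n + N k \<le> N (Suc k)"
  shows "toeplitz_approx k \<in> sft_cover {..<4} marked_toeplitz n"
proof (rule sft_coverI)
  have "toeplitz_approx k i < 2" for i
    unfolding toeplitz_approx_def by (rule mod_less_divisor) simp
  then have "toeplitz_approx k i < 4" for i
    by (rule order.strict_trans) simp
  then show "range (toeplitz_approx k) \<subseteq> {..<4}" by blast
  fix i
  let ?r = "(i - 1) mod int (N k) + 1"
  have per: "(shift ^^ N k) (toeplitz_approx k) = toeplitz_approx k"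
    by (simp add: shift_funpow toeplitz_approx_periodic)
  have pos: "int (N k) > 0" using N_pos[of k] by linarith
  have r: "1 \<le> ?r" "?r \<le> int (N k)" using pos by (simp_all add: add1_zle_eq)
  have "toeplitz_approx k (i + int j) = toeplitz (?r + int j)" if "j < n" for j
  proof -
    have "(i + int j) mod int (N k) = (?r + int j) mod int (N k)"
      by (metis (no_types, opaque_lifting) add.assoc diff_add_cancel mod_add_left_eq)
    then have "toeplitz_approx k (i + int j) = toeplitz_approx k (?r + int j)"
      using shift_periodic_mod[OF per] by metis
    also have "\<dots> = toeplitz (?r + int j)"
      using r that assms by (intro toeplitz_approx_eq) (linarith+)
    finally show ?thesis .
  qed
  then show "\<exists>x'\<in>marked_toeplitz. \<exists>i'. \<forall>j<n. toeplitz_approx k (i + int j) = x' (i' + int j)"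
    using toeplitz_mem by blast
qed

lemma marked_toeplitz_period_stable: "period_stable {..<4} marked_toeplitz"
  unfolding period_stable_def
proof (intro allI impI)
  fix m :: nat assume "m \<ge> 1"
  let ?u = "toeplitz_approx m"
  let ?per = "\<lambda>q. 1 \<le> q \<and> (shift ^^ q) ?u = ?u"
  have per: "?per (N m)"
    using N_pos by (simp add: shift_funpow toeplitz_approx_periodic)
  define p where "p = (LEAST q. ?per q)"
  have p: "?per p" unfolding p_def using per by (rule LeastI)
  have p_min: "\<not> ?per q" if "q < p" for q
    using that not_less_Least[of q ?per] unfolding p_def by blast
  have "p \<le> N m" unfolding p_def using per by (rule Least_le)
  then have "(4::nat) ^ p \<le> 4 ^ N m" by (intro power_increasing) auto
  then have "((4::nat) ^ p + 1) * m \<le> (4 ^ N m + 1) * m" by (intro mult_right_mono) auto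
  then have "1 + (4 ^ p + 1) * m + N m \<le> N (Suc m)" using N_growth[of m] by linarith
  then have "?u \<in> sft_cover {..<4} marked_toeplitz (1 + (card {..<4::nat} ^ p + 1) * m)"
    by (intro toeplitz_approx_in_cover) (simp del: N.simps)
  then have "?u \<in> points_of_period p
      (sft_cover {..<4} marked_toeplitz (1 + (card {..<4::nat} ^ p + 1) * m))"
    unfolding points_of_period_def using p p_min by blast
  from stable_period_window[OF _ this] p
  show "\<exists>n\<ge>1. \<exists>p\<ge>1.
       points_of_period p (sft_cover {..<4} marked_toeplitz n) =
         points_of_period p (sft_cover {..<4} marked_toeplitz (n + m)) \<and>
       points_of_period p (sft_cover {..<4} marked_toeplitz n) \<noteq> {}"
    by blast
qed

theorem mainTheorem5:
  shows "\<exists>(A :: nat set) X. subshift A X \<and> period_stable A X \<and>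
           (\<forall>x\<in>X. \<not> periodic_point x) \<and> \<not> language_stable A X"
proof (intro exI conjI)
  show "subshift {..<4} marked_toeplitz" by (rule marked_toeplitz_subshift)
  show "period_stable {..<4} marked_toeplitz" by (rule marked_toeplitz_period_stable)
  show "\<forall>x\<in>marked_toeplitz. \<not> periodic_point x" using marked_toeplitz_aperiodic by blast
  show "\<not> language_stable {..<4} marked_toeplitz"
    using marked_toeplitz_cover_strict unfolding language_stable_def by auto
qed

end
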